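(* Let $w\in S_n$ and $w'\in S_k$, and let $w''\in S_{n+k}$ have one-line notation $w'(1)+n,\dots,w'(k)+n,w(1),\dots,w(n)$. Then $\mathfrak G_{w''}(x_1,\dots,x_{n+k})=\mathfrak G_w(x_{k+1},\dots,x_{k+n})\,\mathfrak G_{w'}(x_1,\dots,x_k)\prod_{i=1}^k x_i^n$.
   Context: Grothendieck polynomials: for $w\in S_N$, $\mathfrak G_w\in\mathbb Z[x_1,\dots,x_N]$ is defined by $\mathfrak G_{w_0}=x_1^{N-1}\cdots x_{N-1}$ for $w_0=N\,(N-1)\cdots1$, and $\mathfrak G_w=\partial_i((1-x_{i+1})\mathfrak G_{ws_i})$ whenever $w(i)<w(i+1)$, where $ws_i$ swaps entries in positions $i,i+1$ and $\partial_if=(f-s_if)/(x_i-x_{i+1})$; $\mathfrak G_w(y_1,\dots,y_N)$ denotes the result of substituting $y_i$ for $x_i$. *)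

theory Defs
  imports Main "HOL-Library.Poly_Mapping" "HOL-Combinatorics.Permutations"
begin

text \<open>Integer polynomials in the variables \<open>x\<^sub>0, x\<^sub>1, x\<^sub>2, \<dots>\<close>, as finitely supported maps from
  exponent vectors to coefficients; multiplication is the convolution product of
  \<^theory>\<open>HOL-Library.Poly_Mapping\<close>. The ring in variables \<open>x\<^sub>1, \<dots>, x\<^sub>N\<close> is the subring of
  polynomials involving only these; \<open>x\<^sub>0\<close> is never used.\<close>

type_synonym zpoly = "(nat \<Rightarrow>\<^sub>0 nat) \<Rightarrow>\<^sub>0 int"

definition Var :: "nat \<Rightarrow> zpoly" where
  "Var i = Poly_Mapping.single (Poly_Mapping.single i 1) 1"

definition substitute :: "(nat \<Rightarrow> zpoly) \<Rightarrow> zpoly \<Rightarrow> zpoly" where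
  "substitute y f =
     (\<Sum>m\<in>Poly_Mapping.keys f. of_int (Poly_Mapping.lookup f m) *
        (\<Prod>v\<in>Poly_Mapping.keys m. y v ^ Poly_Mapping.lookup m v))"

definition swap_vars :: "nat \<Rightarrow> zpoly \<Rightarrow> zpoly" where
  "swap_vars i f = substitute (\<lambda>j. Var (transpose i (i + 1) j)) f"

text \<open>The quotient \<open>(f - s\<^sub>i f) / (x\<^sub>i - x\<^sub>i\<^sub>+\<^sub>1)\<close>: the division is exact, and the quotient is unique
  because the polynomial ring is an integral domain.\<close>

definition divided_diff :: "nat \<Rightarrow> zpoly \<Rightarrow> zpoly" where
  "divided_diff i f = (THE g. (Var i - Var (i + 1)) * g = f - swap_vars i f)"

text \<open>Elements of \<open>S\<^sub>N\<close> are functions \<open>w\<close> on the naturals with \<open>w permutes {1..N}\<close>; in particular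
  they are the identity outside \<open>{1..N}\<close>.\<close>

definition longest_perm :: "nat \<Rightarrow> nat \<Rightarrow> nat" where
  "longest_perm N i = (if i \<in> {1..N} then N + 1 - i else i)"

inductive is_grothendieck :: "nat \<Rightarrow> (nat \<Rightarrow> nat) \<Rightarrow> zpoly \<Rightarrow> bool" for N :: nat where
  longest: "is_grothendieck N (longest_perm N) (\<Prod>i\<in>{1..<N}. Var i ^ (N - i))"
| ascent: "\<lbrakk>w permutes {1..N}; 1 \<le> i; i < N; w i < w (i + 1);
     is_grothendieck N (w \<circ> transpose i (i + 1)) f\<rbrakk>
   \<Longrightarrow> is_grothendieck N w (divided_diff i ((1 - Var (i + 1)) * f))"

text \<open>Each \<open>w\<close> in \<open>S\<^sub>N\<close> has exactly one polynomial satisfying the relation: the choice of ascents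
  does not matter because the operators \<open>f \<mapsto> \<partial>\<^sub>i ((1 - x\<^sub>i\<^sub>+\<^sub>1) f)\<close> satisfy the braid relations.\<close>

definition grothendieck :: "nat \<Rightarrow> (nat \<Rightarrow> nat) \<Rightarrow> zpoly" where
  "grothendieck N w = (THE f. is_grothendieck N w f)"

text \<open>The permutation with one-line notation \<open>w'(1) + n, \<dots>, w'(k) + n, w(1), \<dots>, w(n)\<close>.\<close>

definition skew_concat :: "nat \<Rightarrow> (nat \<Rightarrow> nat) \<Rightarrow> nat \<Rightarrow> (nat \<Rightarrow> nat) \<Rightarrow> nat \<Rightarrow> nat" where
  "skew_concat k w' n w i =
     (if i \<in> {1..k} then w' i + n else if i \<in> {k + 1..k + n} then w (i - k) else i)"

end

theory Submission
  imports Defs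
begin

text \<open>The operators \<open>\<pi>\<^sub>i f = \<partial>\<^sub>i ((1 - x\<^sub>i\<^sub>+\<^sub>1) f)\<close> satisfy the commutation and braid relations, so the
  recursion determines \<open>\<GG>\<^sub>w\<close> uniquely. The product formula is then checked along the recursion: it holds
  for the longest permutations, and an ascent of \<open>w\<close> at \<open>i\<close> (of \<open>w'\<close> at \<open>i\<close>) is an ascent of the
  concatenation at \<open>k + i\<close> (at \<open>i\<close>). In either case the other two factors are symmetric in the two
  variables that the operator exchanges, hence they can be pulled out of it.\<close>

section \<open>Substitution as a ring homomorphism\<close>

definition monomial_value :: "(nat \<Rightarrow> zpoly) \<Rightarrow> (nat \<Rightarrow>\<^sub>0 nat) \<Rightarrow> zpoly" where
  "monomial_value y m = (\<Prod>v\<in>Poly_Mapping.keys m. y v ^ Poly_Mapping.lookup m v)"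

lemma monomial_value_superset:
  assumes "finite S" "Poly_Mapping.keys m \<subseteq> S"
  shows "monomial_value y m = (\<Prod>v\<in>S. y v ^ Poly_Mapping.lookup m v)"
  unfolding monomial_value_def
  by (rule prod.mono_neutral_left) (use assms in \<open>auto simp: in_keys_iff\<close>)

lemma monomial_value_0 [simp]: "monomial_value y 0 = 1"
  by (simp add: monomial_value_def)

lemma monomial_value_single [simp]: "monomial_value y (Poly_Mapping.single v c) = y v ^ c"
  by (simp add: monomial_value_def)

lemma monomial_value_add: "monomial_value y (m + m') = monomial_value y m * monomial_value y m'"
proof -
  let ?S = "Poly_Mapping.keys m \<union> Poly_Mapping.keys m'"
  have "Poly_Mapping.keys (m + m') \<subseteq> ?S" by (rule Poly_Mapping.keys_add)
  then show ?thesis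
    by (simp add: monomial_value_superset[of ?S] lookup_add power_add prod.distrib)
qed

text \<open>Integer scalars act as constant polynomials, which links the free abelian group on
  exponent vectors to the convolution ring.\<close>

lemma frag_cmul_eq_of_int_mult:
  fixes f :: "'a::comm_monoid_add \<Rightarrow>\<^sub>0 int"
  shows "frag_cmul c f = of_int c * f"
proof -
  have "of_int c * f = Poly_Mapping.map ((*) c) f"
    by (simp add: mult_map_scale_conv_mult flip: single_of_int)
  then show ?thesis
    by (auto intro!: poly_mapping_eqI simp: Poly_Mapping.map.rep_eq when_def)
qed

lemma substitute_eq_frag_extend: "substitute y f = frag_extend (monomial_value y) f"
  by (simp add: substitute_def frag_extend_def frag_cmul_eq_of_int_mult monomial_value_def)

lemma substitute_0 [simp]: "substitute y 0 = 0"
  by (simp add: substitute_eq_frag_extend)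

lemma substitute_add: "substitute y (f + g) = substitute y f + substitute y g"
  by (simp add: substitute_eq_frag_extend frag_extend_add)

lemma substitute_diff: "substitute y (f - g) = substitute y f - substitute y g"
  by (simp add: substitute_eq_frag_extend frag_extend_diff)

lemma substitute_frag_of: "substitute y (frag_of m) = monomial_value y m"
  by (simp add: substitute_eq_frag_extend)

lemma frag_of_add: "frag_of (m + m') = (frag_of m * frag_of m' :: 'a::comm_monoid_add \<Rightarrow>\<^sub>0 int)"
  by (simp add: mult_single)

text \<open>Both sides are additive in each factor, so two nested inductions reduce the claim to
  monomials, where exponents add.\<close>

lemma substitute_mult: "substitute y (f * g) = substitute y f * substitute y g"
proof (induction f rule: frag_induction[OF subset_UNIV])
  case (2 m)
  show ?case
    by (induction g rule: frag_induction[OF subset_UNIV])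
      (simp_all add: substitute_frag_of monomial_value_add right_diff_distrib substitute_diff
        flip: frag_of_add)
qed (simp_all add: left_diff_distrib substitute_diff)

lemma Var_eq_frag_of: "Var v = frag_of (Poly_Mapping.single v 1)"
  by (simp add: Var_def)

lemma substitute_Var [simp]: "substitute y (Var v) = y v"
  by (simp add: Var_eq_frag_of substitute_frag_of)

lemma substitute_1 [simp]: "substitute y 1 = 1"
  using substitute_frag_of[of y 0] by simp

lemma substitute_power: "substitute y (f ^ c) = substitute y f ^ c"
  by (induction c) (simp_all add: substitute_mult)

lemma substitute_prod: "substitute y (\<Prod>i\<in>I. f i) = (\<Prod>i\<in>I. substitute y (f i))"
  by (induction I rule: infinite_finite_induct) (simp_all add: substitute_mult)

lemmas substitute_hom = substitute_add substitute_diff substitute_mult substitute_power substitute_prod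

lemma frag_of_eq_monomial_value: "frag_of m = monomial_value Var m"
proof (induction m rule: update_induct)
  case const
  show ?case by simp
next
  case (update m a b)
  have "Poly_Mapping.update a b m = Poly_Mapping.single a b + m"
    using update(1) by (auto intro!: poly_mapping_eqI simp: lookup_update lookup_add lookup_single in_keys_iff)
  moreover have "frag_of (Poly_Mapping.single a b) = Var a ^ b"
  proof (induction b)
    case (Suc b)
    have "Poly_Mapping.single a (Suc b) = Poly_Mapping.single a 1 + Poly_Mapping.single a b"
      by (simp flip: single_add)
    then show ?case by (simp add: frag_of_add Suc Var_eq_frag_of)
  qed simp
  ultimately show ?case
    by (simp add: frag_of_add monomial_value_add update)
qed

text \<open>The variables generate the ring: \<open>0\<close> is \<open>1 - 1\<close>, and
  differences supply all integer coefficients.\<close>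

lemma zpoly_induct [case_names one diff mult Var]:
  fixes f :: zpoly
  assumes one: "P 1"
    and diff: "\<And>f g. P f \<Longrightarrow> P g \<Longrightarrow> P (f - g)"
    and mult: "\<And>f g. P f \<Longrightarrow> P g \<Longrightarrow> P (f * g)"
    and Var: "\<And>v. P (Var v)"
  shows "P f"
proof (induction f rule: frag_induction[OF subset_UNIV])
  case 1
  show ?case using diff[OF one one] by simp
next
  case (2 m)
  have power: "P (Var v ^ c)" for v c
    by (induction c) (auto intro: one mult Var)
  have "P (\<Prod>v\<in>S. Var v ^ Poly_Mapping.lookup m v)" for S
    by (induction S rule: infinite_finite_induct) (auto intro: one mult power)
  then show ?case by (simp add: frag_of_eq_monomial_value monomial_value_def)
qed (rule diff)

lemma substitute_substitute:
  "substitute y (substitute z f) = substitute (\<lambda>v. substitute y (z v)) f"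
  by (induction f rule: zpoly_induct) (simp_all add: substitute_hom)

lemma substitute_Var_id [simp]: "substitute Var f = f"
  by (induction f rule: zpoly_induct) (simp_all add: substitute_hom)

text \<open>Makes the denominators \<open>Var i - Var (i + 1)\<close> nonzero, hence
  cancellable.\<close>

lemma Var_eq_iff [simp]: "Var i = Var j \<longleftrightarrow> i = j"
  by (metis Var_eq_frag_of lookup_single_eq lookup_single_not_eq zero_neq_one)

section \<open>Adjacent swaps of variables and exactness of the divided difference\<close>

lemmas swap_vars_hom = substitute_hom[where y = "\<lambda>j. Var (transpose i (i + 1) j)" for i, folded swap_vars_def]

lemma swap_vars_1 [simp]: "swap_vars i 1 = 1"
  by (simp add: swap_vars_def)

lemma swap_vars_Var: "swap_vars i (Var j) = Var (transpose i (i + 1) j)"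
  by (simp add: swap_vars_def)

lemma swap_vars_swap_vars [simp]: "swap_vars i (swap_vars i f) = f"
  by (simp add: swap_vars_def substitute_substitute)

text \<open>A twisted Leibniz rule carries divisibility through products, which leaves only single
  variables.\<close>

lemma dvd_diff_swap_vars: "Var i - Var (i + 1) dvd f - swap_vars i f"
proof (induction f rule: zpoly_induct)
  case (diff f g)
  have "f - g - swap_vars i (f - g) = (f - swap_vars i f) - (g - swap_vars i g)"
    by (simp add: swap_vars_hom)
  then show ?case using diff by (metis dvd_diff)
next
  case (mult f g)
  have "f * g - swap_vars i (f * g) = (f - swap_vars i f) * g + swap_vars i f * (g - swap_vars i g)"
    by (simp add: swap_vars_hom algebra_simps)
  then show ?case using mult by simp
next
  case (Var v)
  show ?case
    by (auto simp: swap_vars_Var transpose_def) (metis dvd_refl dvd_minus_iff minus_diff_eq)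
qed simp

text \<open>Divisibility gives existence of the quotient and cancellation its uniqueness, so the
  definite description is meaningful.\<close>

lemma divided_diff_mult: "(Var i - Var (i + 1)) * divided_diff i f = f - swap_vars i f"
proof -
  obtain g where g: "(Var i - Var (i + 1)) * g = f - swap_vars i f"
    using dvd_diff_swap_vars by (metis dvd_def)
  show ?thesis
    unfolding divided_diff_def
    by (rule theI[where a = g]) (use g in \<open>auto simp flip: g\<close>)
qed

section \<open>Isobaric divided differences\<close>

definition isobaric_diff :: "nat \<Rightarrow> zpoly \<Rightarrow> zpoly" where
  "isobaric_diff i f = divided_diff i ((1 - Var (i + 1)) * f)"

text \<open>The swap exchanges \<open>1 - Var i\<close> and \<open>1 - Var (i + 1)\<close>. This
  division-free equation stands in for the quotient in the computations below.\<close>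

lemma isobaric_diff_mult:
  "(Var i - Var (i + 1)) * isobaric_diff i f
    = (1 - Var (i + 1)) * f - (1 - Var i) * swap_vars i f"
  by (simp only: isobaric_diff_def divided_diff_mult) (simp add: swap_vars_hom swap_vars_Var)

lemma isobaric_diff_eqI:
  assumes "(Var i - Var (i + 1)) * g = (1 - Var (i + 1)) * f - (1 - Var i) * swap_vars i f"
  shows "isobaric_diff i f = g"
proof -
  have "(Var i - Var (i + 1)) * isobaric_diff i f = (Var i - Var (i + 1)) * g"
    by (simp only: isobaric_diff_mult assms)
  then show ?thesis by simp
qed

lemma isobaric_diff_diff: "isobaric_diff i (f - g) = isobaric_diff i f - isobaric_diff i g"
  by (rule isobaric_diff_eqI, subst right_diff_distrib, subst (1 2) isobaric_diff_mult)
    (simp add: swap_vars_hom algebra_simps)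

text \<open>A symmetric \<open>g\<close> factors out of both \<open>f\<close> and its swap; this
  later extracts the other factors of the product formula.\<close>

lemma isobaric_diff_mult_symmetric:
  assumes "swap_vars i g = g"
  shows "isobaric_diff i (g * f) = g * isobaric_diff i f"
proof (rule isobaric_diff_eqI)
  have "(Var i - Var (i + 1)) * (g * isobaric_diff i f)
      = g * ((Var i - Var (i + 1)) * isobaric_diff i f)"
    by (simp add: algebra_simps)
  also have "\<dots> = (1 - Var (i + 1)) * (g * f) - (1 - Var i) * swap_vars i (g * f)"
    by (subst isobaric_diff_mult) (simp add: swap_vars_hom assms algebra_simps)
  finally show "(Var i - Var (i + 1)) * (g * isobaric_diff i f) = \<dots>" .
qed

lemma substitute_swap_vars:
  assumes "\<And>v. y (transpose i (i + 1) v) = swap_vars a (y v)"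
  shows "substitute y (swap_vars i f) = swap_vars a (substitute y f)"
  using assms by (simp add: swap_vars_def substitute_substitute)

text \<open>Such a \<open>y\<close> carries the defining equation of the operator at
  \<open>i\<close> to the one at \<open>a\<close>. Distant swaps, index shifts and the vanishing of
  \<open>Var 0\<close> are all instances.\<close>

lemma substitute_isobaric_diff:
  assumes "y i = Var a" and "y (i + 1) = Var (a + 1)"
    and "\<And>v. y (transpose i (i + 1) v) = swap_vars a (y v)"
  shows "substitute y (isobaric_diff i f) = isobaric_diff a (substitute y f)"
proof (rule isobaric_diff_eqI[symmetric])
  have "(Var a - Var (a + 1)) * substitute y (isobaric_diff i f)
      = substitute y ((Var i - Var (i + 1)) * isobaric_diff i f)"
    using assms(1,2) by (simp add: substitute_hom)
  also have "\<dots> = (1 - Var (a + 1)) * substitute y f - (1 - Var a) * swap_vars a (substitute y f)"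
    using assms by (subst isobaric_diff_mult) (simp add: substitute_hom substitute_swap_vars)
  finally show "(Var a - Var (a + 1)) * substitute y (isobaric_diff i f) = \<dots>" .
qed

section \<open>Commutation and braid relations\<close>

lemma swap_vars_isobaric_diff:
  assumes "i + 1 < j \<or> j + 1 < i"
  shows "swap_vars j (isobaric_diff i f) = isobaric_diff i (swap_vars j f)"
  unfolding swap_vars_def[of j]
  by (rule substitute_isobaric_diff) (use assms in \<open>auto simp: swap_vars_Var transpose_def\<close>)

text \<open>Coefficients in \<open>Var i\<close> and \<open>Var (i + 1)\<close> are scalars for the
  operator at \<open>j\<close>, so it can be applied to the defining equation of the operator at
  \<open>i\<close>.\<close>

lemma isobaric_diff_commute:
  assumes "i + 1 < j \<or> j + 1 < i"
  shows "isobaric_diff i (isobaric_diff j f) = isobaric_diff j (isobaric_diff i f)"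
proof (rule isobaric_diff_eqI)
  have sym: "swap_vars j g = g" if "g \<in> {Var i - Var (i + 1), 1 - Var i, 1 - Var (i + 1)}" for g
    using that assms by (auto simp: swap_vars_hom swap_vars_Var transpose_def)
  have "(Var i - Var (i + 1)) * isobaric_diff j (isobaric_diff i f)
      = isobaric_diff j ((Var i - Var (i + 1)) * isobaric_diff i f)"
    by (rule isobaric_diff_mult_symmetric[symmetric]) (use sym in blast)
  also have "\<dots> = (1 - Var (i + 1)) * isobaric_diff j f - (1 - Var i) * isobaric_diff j (swap_vars i f)"
    by (subst isobaric_diff_mult) (simp add: isobaric_diff_diff isobaric_diff_mult_symmetric sym)
  also have "isobaric_diff j (swap_vars i f) = swap_vars i (isobaric_diff j f)"
    using assms by (intro swap_vars_isobaric_diff[symmetric]) auto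
  finally show "(Var i - Var (i + 1)) * isobaric_diff j (isobaric_diff i f)
      = (1 - Var (i + 1)) * isobaric_diff j f - (1 - Var i) * swap_vars i (isobaric_diff j f)" .
qed

text \<open>The swap negates both numerator and denominator.\<close>

lemma swap_vars_isobaric_diff_self: "swap_vars i (isobaric_diff i f) = isobaric_diff i f"
proof -
  have "- (Var i - Var (i + 1)) * swap_vars i (isobaric_diff i f)
      = swap_vars i ((Var i - Var (i + 1)) * isobaric_diff i f)"
    by (simp add: swap_vars_hom swap_vars_Var)
  also have "\<dots> = - ((Var i - Var (i + 1)) * isobaric_diff i f)"
    by (subst (1 2) isobaric_diff_mult) (simp add: swap_vars_hom swap_vars_Var)
  finally have "(Var i - Var (i + 1)) * swap_vars i (isobaric_diff i f)
      = (Var i - Var (i + 1)) * isobaric_diff i f"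
    by (simp only: mult_minus_left neg_equal_iff_equal)
  then show ?thesis by simp
qed

lemma swap_vars_braid:
  "swap_vars i (swap_vars (i + 1) (swap_vars i f)) = swap_vars (i + 1) (swap_vars i (swap_vars (i + 1) f))"
proof -
  have "transpose i (i + 1) (transpose (i + 1) (i + 2) (transpose i (i + 1) v))
      = transpose (i + 1) (i + 2) (transpose i (i + 1) (transpose (i + 1) (i + 2) v))" for v
    by (auto simp: transpose_def)
  then show ?thesis by (simp add: swap_vars_def substitute_substitute)
qed

text \<open>Over the common denominator \<open>?K\<close>, both sides have the numerator
  \<open>E\<close>, a combination of the six images of \<open>f\<close> under the group generated by
  the two swaps.\<close>

lemma isobaric_diff_braid:
  "isobaric_diff i (isobaric_diff (i + 1) (isobaric_diff i f))
    = isobaric_diff (i + 1) (isobaric_diff i (isobaric_diff (i + 1) f))"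
proof -
  let ?a = "Var i" and ?b = "Var (i + 1)" and ?c = "Var (i + 2)"
  let ?s = "swap_vars i" and ?t = "swap_vars (i + 1)"
  have s: "?s ?a = ?b" "?s ?b = ?a" "?s ?c = ?c" and t: "?t ?a = ?a" "?t ?b = ?c" "?t ?c = ?b"
    by (simp_all add: swap_vars_Var transpose_def)
  have Ds: "(?a - ?b) * isobaric_diff i g = (1 - ?b) * g - (1 - ?a) * ?s g" for g
    by (rule isobaric_diff_mult)
  have Dt: "(?b - ?c) * isobaric_diff (i + 1) g = (1 - ?c) * g - (1 - ?b) * ?t g" for g
    using isobaric_diff_mult[of "i + 1" g] by simp
  define p0 where "p0 = isobaric_diff i f"
  define p1 where "p1 = isobaric_diff (i + 1) p0"
  define p2 where "p2 = isobaric_diff i p1"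
  define q0 where "q0 = isobaric_diff (i + 1) f"
  define q1 where "q1 = isobaric_diff i q0"
  define q2 where "q2 = isobaric_diff (i + 1) q1"
  note hom = swap_vars_hom s t swap_vars_1
  have p0: "(?a - ?b) * p0 = (1 - ?b) * f - (1 - ?a) * ?s f"
    unfolding p0_def by (rule Ds)
  \<comment> \<open>Swapping variables in a defining equation yields one for each translate that the
    next operator produces.\<close>
  have tp0: "(?a - ?c) * ?t p0 = (1 - ?c) * ?t f - (1 - ?a) * ?t (?s f)"
    using arg_cong[OF p0, of ?t] by (simp only: hom)
  have stp0: "(?b - ?c) * ?s (?t p0) = (1 - ?c) * ?s (?t f) - (1 - ?b) * ?s (?t (?s f))"
    using arg_cong[OF tp0, of ?s] by (simp only: hom)
  have p1: "(?b - ?c) * p1 = (1 - ?c) * p0 - (1 - ?b) * ?t p0"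
    unfolding p1_def by (rule Dt)
  \<comment> \<open>\<open>p0\<close> is invariant under \<open>?s\<close>, so only
    \<open>?s (?t p0)\<close> is a new translate.\<close>
  have sp1: "(?a - ?c) * ?s p1 = (1 - ?c) * p0 - (1 - ?a) * ?s (?t p0)"
    using arg_cong[OF p1, of ?s]
    by (simp only: hom) (simp add: p0_def swap_vars_isobaric_diff_self)
  have p2: "(?a - ?b) * p2 = (1 - ?b) * p1 - (1 - ?a) * ?s p1"
    unfolding p2_def by (rule Ds)
  have q0: "(?b - ?c) * q0 = (1 - ?c) * f - (1 - ?b) * ?t f"
    unfolding q0_def by (rule Dt)
  have sq0: "(?a - ?c) * ?s q0 = (1 - ?c) * ?s f - (1 - ?a) * ?s (?t f)"
    using arg_cong[OF q0, of ?s] by (simp only: hom)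
  have tsq0: "(?a - ?b) * ?t (?s q0) = (1 - ?b) * ?t (?s f) - (1 - ?a) * ?s (?t (?s f))"
    using arg_cong[OF sq0, of ?t] by (simp only: hom swap_vars_braid)
  have q1: "(?a - ?b) * q1 = (1 - ?b) * q0 - (1 - ?a) * ?s q0"
    unfolding q1_def by (rule Ds)
  have tq1: "(?a - ?c) * ?t q1 = (1 - ?c) * q0 - (1 - ?a) * ?t (?s q0)"
    using arg_cong[OF q1, of ?t]
    by (simp only: hom) (simp add: q0_def swap_vars_isobaric_diff_self)
  have q2: "(?b - ?c) * q2 = (1 - ?c) * q1 - (1 - ?b) * ?t q1"
    unfolding q2_def by (rule Dt)
  define E where "E = (1 - ?b) * (1 - ?c)\<^sup>2 * f - (1 - ?a) * (1 - ?c)\<^sup>2 * ?s f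
    - (1 - ?b)\<^sup>2 * (1 - ?c) * ?t f + (1 - ?b)\<^sup>2 * (1 - ?a) * ?t (?s f)
    + (1 - ?a)\<^sup>2 * (1 - ?c) * ?s (?t f) - (1 - ?a)\<^sup>2 * (1 - ?b) * ?s (?t (?s f))"
  let ?K = "(?a - ?b) * (?a - ?c) * (?b - ?c)"
  have "?K * p2 = (?a - ?c) * (?b - ?c) * ((?a - ?b) * p2)"
    by (simp only: ac_simps)
  also have "\<dots> = (?a - ?c) * (1 - ?b) * ((?b - ?c) * p1) - (?b - ?c) * (1 - ?a) * ((?a - ?c) * ?s p1)"
    unfolding p2 by (simp only: algebra_simps)
  \<comment> \<open>The two \<open>p0\<close> terms merge by
    \<open>(a - c)(1 - b) - (b - c)(1 - a) = (a - b)(1 - c)\<close>, which supplies the denominator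
    of \<open>p0\<close>.\<close>
  also have "\<dots> = (1 - ?c)\<^sup>2 * ((?a - ?b) * p0) - (1 - ?b)\<^sup>2 * ((?a - ?c) * ?t p0)
      + (1 - ?a)\<^sup>2 * ((?b - ?c) * ?s (?t p0))"
    unfolding p1 sp1 by (simp add: algebra_simps power2_eq_square)
  also have "\<dots> = E"
    unfolding p0 tp0 stp0 E_def by (simp add: algebra_simps)
  finally have p: "?K * p2 = E" .
  have "?K * q2 = (?a - ?c) * (?a - ?b) * ((?b - ?c) * q2)"
    by (simp only: ac_simps)
  also have "\<dots> = (?a - ?c) * (1 - ?c) * ((?a - ?b) * q1) - (?a - ?b) * (1 - ?b) * ((?a - ?c) * ?t q1)"
    unfolding q2 by (simp only: algebra_simps)
  also have "\<dots> = (1 - ?b) * (1 - ?c) * ((?b - ?c) * q0) - (1 - ?a) * (1 - ?c) * ((?a - ?c) * ?s q0)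
      + (1 - ?a) * (1 - ?b) * ((?a - ?b) * ?t (?s q0))"
    unfolding q1 tq1 by (simp add: algebra_simps power2_eq_square)
  also have "\<dots> = E"
    unfolding q0 sq0 tsq0 E_def by (simp add: algebra_simps power2_eq_square)
  finally have "?K * p2 = ?K * q2" using p by simp
  then have "p2 = q2" by simp
  then show ?thesis by (simp only: p0_def p1_def p2_def q0_def q1_def q2_def)
qed

section \<open>Existence and uniqueness of Grothendieck polynomials\<close>

lemma longest_perm_permutes: "longest_perm N permutes {1..N}"
  by (rule inj_imp_permutes) (auto simp: longest_perm_def inj_on_def)

text \<open>Each step drops by at least one; starting from \<open>w 1 \<le> N\<close> on the left
  and \<open>1 \<le> w N\<close> on the right pins \<open>w i + i\<close> to
  \<open>N + 1\<close>.\<close>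

lemma antitone_permutes_eq_longest_perm:
  assumes w: "w permutes {1..N}" and desc: "\<And>i. 1 \<le> i \<Longrightarrow> i < N \<Longrightarrow> w (i + 1) < w i"
  shows "w = longest_perm N"
proof
  fix i
  have upper: "w i + i \<le> N + 1" if "1 \<le> i" "i \<le> N" for i
    using that
  proof (induction i rule: nat_induct_at_least)
    case base
    then show ?case using permutes_in_image[OF w, of 1] by auto
  next
    case (Suc i)
    then show ?case using desc[of i] by auto
  qed
  have lower: "N + 1 \<le> w i + i" if "i \<le> N" "1 \<le> i" for i
    using that
  proof (induction i rule: inc_induct)
    case base
    then show ?case using permutes_in_image[OF w, of N] by auto
  next
    case (step i)
    then show ?case using desc[of i] by auto
  qed
  show "w i = longest_perm N i"
  proof (cases "i \<in> {1..N}")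
    case True
    then show ?thesis using upper[of i] lower[of i] by (auto simp: longest_perm_def)
  next
    case False
    then show ?thesis using permutes_not_in[OF w False] by (auto simp: longest_perm_def)
  qed
qed

text \<open>The sums differ by \<open>w (i + 1) - w i\<close>. The sum falls as the recursion climbs
  to the longest permutation, so it serves as induction measure.\<close>

lemma weighted_sum_ascent_less:
  fixes w :: "nat \<Rightarrow> nat"
  assumes "1 \<le> i" "i < N" "w i < w (i + 1)"
  shows "(\<Sum>j\<in>{1..N}. j * (w \<circ> transpose i (i + 1)) j) < (\<Sum>j\<in>{1..N}. j * w j)"
proof -
  have eq: "{1..N} = {i, i + 1} \<union> ({1..N} - {i, i + 1})" using assms by auto
  have split: "(\<Sum>j\<in>{1..N}. g j) = g i + g (i + 1) + (\<Sum>j\<in>{1..N} - {i, i + 1}. g j)"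
    for g :: "nat \<Rightarrow> nat"
    by (subst eq, subst sum.union_disjoint) auto
  have "(\<Sum>j\<in>{1..N} - {i, i + 1}. j * (w \<circ> transpose i (i + 1)) j)
      = (\<Sum>j\<in>{1..N} - {i, i + 1}. j * w j)"
    by (intro sum.cong) (auto simp: transpose_def)
  then show ?thesis
    unfolding split using assms by (simp add: algebra_simps)
qed

lemma is_grothendieck_permutes: "is_grothendieck N w f \<Longrightarrow> w permutes {1..N}"
  by (induction rule: is_grothendieck.induct) (fact longest_perm_permutes, assumption)

lemma permutes_transpose_Suc:
  fixes w :: "nat \<Rightarrow> nat"
  shows "w permutes {1..N} \<Longrightarrow> 1 \<le> i \<Longrightarrow> i < N \<Longrightarrow> w \<circ> transpose i (i + 1) permutes {1..N}"
  by (rule permutes_compose[OF permutes_swap_id]) auto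

lemma is_grothendieck_ascent:
  "\<lbrakk>1 \<le> i; i < N; w i < w (i + 1); is_grothendieck N (w \<circ> transpose i (i + 1)) f\<rbrakk>
   \<Longrightarrow> is_grothendieck N w (isobaric_diff i f)"
  unfolding isobaric_diff_def
proof (rule is_grothendieck.ascent)
  assume "1 \<le> i" "i < N" "is_grothendieck N (w \<circ> transpose i (i + 1)) f"
  then have "w \<circ> transpose i (i + 1) \<circ> transpose i (i + 1) permutes {1..N}"
    by (intro permutes_transpose_Suc is_grothendieck_permutes)
  then show "w permutes {1..N}" by (simp add: o_assoc[symmetric])
qed

text \<open>Following any ascent lowers the weighted sum; without an ascent only the longest
  permutation remains.\<close>

lemma is_grothendieck_exists:
  assumes "w permutes {1..N}"
  shows "\<exists>f. is_grothendieck N w f"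
  using assms
proof (induction "\<Sum>j\<in>{1..N}. j * w j" arbitrary: w rule: less_induct)
  case less
  show ?case
  proof (cases "\<exists>i. 1 \<le> i \<and> i < N \<and> w i < w (i + 1)")
    case True
    then obtain i where i: "1 \<le> i" "i < N" "w i < w (i + 1)" by blast
    then obtain f where "is_grothendieck N (w \<circ> transpose i (i + 1)) f"
      using less weighted_sum_ascent_less permutes_transpose_Suc by meson
    with i show ?thesis by (blast intro: is_grothendieck_ascent)
  next
    case False
    have "w = longest_perm N"
    proof (rule antitone_permutes_eq_longest_perm[OF less.prems])
      fix i assume "1 \<le> i" "i < N"
      moreover have "w i \<noteq> w (i + 1)"
        using permutes_inj[OF less.prems] by (metis injD n_not_Suc_n Suc_eq_plus1)
      ultimately show "w (i + 1) < w i" using False by fastforce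
    qed
    then show ?thesis using is_grothendieck.longest by blast
  qed
qed

text \<open>Two derivations of the same permutation may start from different ascents; they are joined
  by a common permutation above both, using the commutation and braid relations.\<close>

lemma is_grothendieck_unique:
  assumes "is_grothendieck N w f" and "is_grothendieck N w g"
  shows "f = g"
  using assms
proof (induction "\<Sum>j\<in>{1..N}. j * w j" arbitrary: w f g rule: less_induct)
  case less
  note w = is_grothendieck_permutes[OF less.prems(1)]
  have unique: "u = v" if "1 \<le> i" "i < N" "w i < w (i + 1)"
    "is_grothendieck N (w \<circ> transpose i (i + 1)) u" "is_grothendieck N (w \<circ> transpose i (i + 1)) v"
    for i u v
    using less.hyps weighted_sum_ascent_less that by blast
  have unique_far: "isobaric_diff i u = isobaric_diff j v"
    if i: "1 \<le> i" "i < N" "w i < w (i + 1)" "is_grothendieck N (w \<circ> transpose i (i + 1)) u"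
      and j: "1 \<le> j" "j < N" "w j < w (j + 1)" "is_grothendieck N (w \<circ> transpose j (j + 1)) v"
      and ij: "i + 1 < j" for i j u v
  proof -
    have comm: "w \<circ> transpose i (i + 1) \<circ> transpose j (j + 1)
        = w \<circ> transpose j (j + 1) \<circ> transpose i (i + 1)"
      using ij by (auto simp: fun_eq_iff transpose_def)
    \<comment> \<open>The positions are disjoint, so each ascent survives the other swap and this
      permutation lies above both neighbours of \<open>w\<close>.\<close>
    obtain h where h: "is_grothendieck N (w \<circ> transpose i (i + 1) \<circ> transpose j (j + 1)) h"
      using is_grothendieck_exists permutes_transpose_Suc w i j by meson
    have "is_grothendieck N (w \<circ> transpose i (i + 1)) (isobaric_diff j h)"
      by (rule is_grothendieck_ascent) (use h j ij in \<open>auto simp: transpose_def\<close>)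
    then have u: "u = isobaric_diff j h" using unique i by blast
    have "is_grothendieck N (w \<circ> transpose j (j + 1)) (isobaric_diff i h)"
      by (rule is_grothendieck_ascent) (use h[unfolded comm] i ij in \<open>auto simp: transpose_def\<close>)
    then have "v = isobaric_diff i h" using unique j by blast
    with u show ?thesis using isobaric_diff_commute ij by simp
  qed
  have unique_adjacent: "isobaric_diff i u = isobaric_diff (i + 1) v"
    if i: "1 \<le> i" "i < N" "w i < w (i + 1)" "is_grothendieck N (w \<circ> transpose i (i + 1)) u"
      and j: "i + 1 < N" "w (i + 1) < w (i + 2)"
        "is_grothendieck N (w \<circ> transpose (i + 1) (i + 2)) v" for i u v
  proof -
    let ?s = "transpose i (i + 1)" and ?t = "transpose (i + 1) (i + 2)"
    have braid: "w \<circ> ?s \<circ> ?t \<circ> ?s = w \<circ> ?t \<circ> ?s \<circ> ?t"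
      by (auto simp: fun_eq_iff transpose_def)
    \<comment> \<open>The common upper permutation reverses the increasing entries at
      \<open>i\<close>, \<open>i + 1\<close>, \<open>i + 2\<close>; the two chains up to it are the
      two reduced words of this reversal.\<close>
    have "w \<circ> ?s \<circ> ?t \<circ> ?s permutes {1..N}"
      by (intro permutes_compose permutes_swap_id w) (use i j in auto)
    then obtain h where h: "is_grothendieck N (w \<circ> ?s \<circ> ?t \<circ> ?s) h"
      using is_grothendieck_exists by blast
    have h1: "is_grothendieck N (w \<circ> ?s \<circ> ?t) (isobaric_diff i h)"
      by (rule is_grothendieck_ascent) (use h i j in \<open>auto simp: transpose_def\<close>)
    have "is_grothendieck N (w \<circ> ?s) (isobaric_diff (i + 1) (isobaric_diff i h))"
      by (rule is_grothendieck_ascent) (use h1 i j in \<open>auto simp: transpose_def\<close>)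
    then have u: "u = isobaric_diff (i + 1) (isobaric_diff i h)" using unique i by blast
    have h1: "is_grothendieck N (w \<circ> ?t \<circ> ?s) (isobaric_diff (i + 1) h)"
      by (rule is_grothendieck_ascent) (use h[unfolded braid] i j in \<open>auto simp: transpose_def\<close>)
    have "is_grothendieck N (w \<circ> ?t) (isobaric_diff i (isobaric_diff (i + 1) h))"
      by (rule is_grothendieck_ascent) (use h1 i j in \<open>auto simp: transpose_def\<close>)
    then have "v = isobaric_diff i (isobaric_diff (i + 1) h)"
      using unique[of "i + 1"] i j by simp
    with u show ?thesis using isobaric_diff_braid by simp
  qed
  \<comment> \<open>Excludes that one derivation is the base case while the other uses an
    ascent.\<close>
  have longest_no_ascent: False if "w = longest_perm N" "1 \<le> i" "i < N" "w i < w (i + 1)" for i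
    using that by (auto simp: longest_perm_def)
  show ?case
    using less.prems(1)
  proof cases
    case longest
    from less.prems(2) show ?thesis
      by cases (use longest longest_no_ascent in auto)
  next
    case i: (ascent i u)
    from less.prems(2) show ?thesis
    proof cases
      case longest
      then show ?thesis using i longest_no_ascent by blast
    next
      case j: (ascent j v)
      consider "i = j" | "i + 1 < j" | "j + 1 < i" | "j = i + 1" | "i = j + 1" by linarith
      then have "isobaric_diff i u = isobaric_diff j v"
      proof cases
        case 1
        then show ?thesis using unique i j by blast
      next
        case 2
        then show ?thesis using unique_far i j by blast
      next
        case 3
        then show ?thesis using unique_far[of j v i u] i j by simp
      next
        case 4
        then show ?thesis using unique_adjacent[of i u v] i j by simp
      next
        case 5
        then show ?thesis using unique_adjacent[of j v u] i j by simp
      qed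
      then show ?thesis using i j by (simp add: isobaric_diff_def)
    qed
  qed
qed

lemma grothendieck_eqI: "is_grothendieck N w f \<Longrightarrow> grothendieck N w = f"
  unfolding grothendieck_def using is_grothendieck_unique by blast

lemma is_grothendieck_grothendieck:
  "w permutes {1..N} \<Longrightarrow> is_grothendieck N w (grothendieck N w)"
  using is_grothendieck_exists grothendieck_eqI by metis

section \<open>Skew concatenation\<close>

text \<open>The starting monomial has no variable beyond \<open>N\<close>, and for
  \<open>i < N < j\<close> the operator at \<open>i\<close> commutes with the swap at
  \<open>j\<close>.\<close>

lemma swap_vars_is_grothendieck:
  assumes "is_grothendieck N w f" and "N < j"
  shows "swap_vars j f = f"
  using assms
proof (induction rule: is_grothendieck.induct)
  case longest
  then show ?case
    by (auto simp: swap_vars_hom swap_vars_Var transpose_def intro!: prod.cong)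
next
  case (ascent w i f)
  then show ?case
    using swap_vars_isobaric_diff[of i j f] by (simp add: isobaric_diff_def)
qed

text \<open>Killing the unused variable \<open>x\<^sub>0\<close> expresses that \<open>f\<close> does not involve it.\<close>

lemma substitute_0_is_grothendieck:
  assumes "is_grothendieck N w f"
  shows "substitute (Var(0 := 0)) f = f"
  using assms
proof (induction rule: is_grothendieck.induct)
  case longest
  then show ?case by (auto simp: substitute_hom intro!: prod.cong)
next
  case (ascent w i f)
  \<comment> \<open>The substitution has value \<open>0\<close> at index \<open>0\<close>, and this
    value must be compatible with the swap; the index itself is fixed since
    \<open>1 \<le> i\<close>.\<close>
  have "swap_vars i 0 = 0" by (simp add: swap_vars_def)
  with \<open>1 \<le> i\<close> have "substitute (Var(0 := 0)) (isobaric_diff i f)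
      = isobaric_diff i (substitute (Var(0 := 0)) f)"
    by (intro substitute_isobaric_diff) (auto simp: swap_vars_Var transpose_def)
  then show ?case unfolding isobaric_diff_def ascent.IH .
qed

text \<open>The shifted polynomial lives beyond \<open>Var k\<close>. The critical case is
  \<open>i + 1 = k\<close>: a \<open>Var 0\<close> would be shifted to \<open>Var k\<close>, hence
  it is killed first.\<close>

lemma swap_vars_shift_is_grothendieck:
  assumes "is_grothendieck N w f" and "i < k"
  shows "swap_vars i (substitute (\<lambda>v. Var (k + v)) f) = substitute (\<lambda>v. Var (k + v)) f"
proof -
  have "substitute (\<lambda>v. Var (k + v)) f
      = substitute (\<lambda>v. Var (k + v)) (substitute (Var(0 := 0)) f)"
    using substitute_0_is_grothendieck[OF assms(1)] by simp
  also have "\<dots> = substitute (\<lambda>v. if v = 0 then 0 else Var (k + v)) f"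
    unfolding substitute_substitute by (rule arg_cong[where f = "\<lambda>y. substitute y f"]) auto
  finally have shift: "substitute (\<lambda>v. Var (k + v)) f
      = substitute (\<lambda>v. if v = 0 then 0 else Var (k + v)) f" .
  show ?thesis
    unfolding shift swap_vars_def substitute_substitute
    by (rule arg_cong[where f = "\<lambda>y. substitute y f"])
      (use assms(2) in \<open>auto simp: fun_eq_iff transpose_def\<close>)
qed

text \<open>The transposition permutes \<open>I\<close>. Below, \<open>I\<close> is
  \<open>{1..k}\<close>, with both indices inside for ascents of \<open>w'\<close> and both outside
  for ascents of \<open>w\<close>.\<close>

lemma swap_vars_symmetric_prod:
  assumes "i \<in> I \<longleftrightarrow> i + 1 \<in> I"
  shows "swap_vars i (\<Prod>j\<in>I. Var j ^ n) = (\<Prod>j\<in>I. Var j ^ n)"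
proof -
  have "bij_betw (transpose i (i + 1)) I I"
    using assms by simp
  then show ?thesis
    by (simp add: swap_vars_hom swap_vars_Var prod.reindex_bij_betw[where g = "\<lambda>j. Var j ^ n"])
qed

text \<open>Cut the indices at \<open>k\<close>: below the cut \<open>n + k - i\<close> is
  \<open>(k - i) + n\<close>, and index \<open>k + i\<close> has exponent
  \<open>n - i\<close>.\<close>

lemma longest_prod_append:
  "(\<Prod>i\<in>{1..<n + k}. Var i ^ (n + k - i))
    = (\<Prod>i\<in>{1..<n}. Var (k + i) ^ (n - i)) * (\<Prod>i\<in>{1..<k}. Var i ^ (k - i))
      * (\<Prod>i\<in>{1..k}. Var i ^ n)"
proof -
  \<comment> \<open>The endpoint contributes exponent \<open>0\<close>; closed intervals split
    cleanly at \<open>k\<close>.\<close>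
  have closed: "(\<Prod>i\<in>{1..<N}. y i ^ (N - i)) = (\<Prod>i\<in>{1..N}. y i ^ (N - i))"
    for N and y :: "nat \<Rightarrow> zpoly"
    by (rule prod.mono_neutral_left) auto
  have "{1..n + k} = {1..k} \<union> (+) k ` {1..n}"
    by auto
  then have "(\<Prod>i\<in>{1..n + k}. Var i ^ (n + k - i))
      = (\<Prod>i\<in>{1..k}. Var i ^ (n + k - i)) * (\<Prod>i\<in>(+) k ` {1..n}. Var i ^ (n + k - i))"
    by (simp only:) (rule prod.union_disjoint, auto)
  also have "(\<Prod>i\<in>(+) k ` {1..n}. Var i ^ (n + k - i)) = (\<Prod>i\<in>{1..n}. Var (k + i) ^ (n - i))"
    by (subst prod.reindex) auto
  also have "(\<Prod>i\<in>{1..k}. Var i ^ (n + k - i))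
      = (\<Prod>i\<in>{1..k}. Var i ^ (k - i)) * (\<Prod>i\<in>{1..k}. Var i ^ n)"
    unfolding prod.distrib[symmetric] by (intro prod.cong) (auto simp: add.commute simp flip: power_add)
  finally show ?thesis
    unfolding closed by (simp only: ac_simps)
qed

section \<open>Concatenation along the recursion\<close>

lemma skew_concat_transpose_left:
  assumes "1 \<le> i" "i < k"
  shows "skew_concat k w' n w \<circ> transpose i (i + 1) = skew_concat k (w' \<circ> transpose i (i + 1)) n w"
  using assms by (auto simp: fun_eq_iff skew_concat_def transpose_def)

lemma skew_concat_transpose_right:
  assumes "1 \<le> i" "i < n"
  shows "skew_concat k w' n w \<circ> transpose (k + i) (k + i + 1)
    = skew_concat k w' n (w \<circ> transpose i (i + 1))"
  using assms by (auto simp: fun_eq_iff skew_concat_def transpose_def)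

lemma skew_concat_longest:
  "skew_concat k (longest_perm k) n (longest_perm n) = longest_perm (n + k)"
  by (auto simp: fun_eq_iff skew_concat_def longest_perm_def)

text \<open>Induction over \<open>w'\<close> with \<open>w\<close> fixed; adding \<open>n\<close>
  preserves the ascents of \<open>w'\<close>. The case of the longest \<open>w'\<close> is a
  hypothesis because it depends on \<open>w\<close>.\<close>

lemma is_grothendieck_skew_concat_left:
  assumes w': "is_grothendieck k w' f'" and w: "is_grothendieck n w f"
    and base: "is_grothendieck (n + k) (skew_concat k (longest_perm k) n w)
      (substitute (\<lambda>i. Var (k + i)) f * (\<Prod>i\<in>{1..<k}. Var i ^ (k - i)) * (\<Prod>i\<in>{1..k}. Var i ^ n))"
  shows "is_grothendieck (n + k) (skew_concat k w' n w)
    (substitute (\<lambda>i. Var (k + i)) f * f' * (\<Prod>i\<in>{1..k}. Var i ^ n))"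
  using w'
proof (induction rule: is_grothendieck.induct)
  case longest
  show ?case by (rule base)
next
  case (ascent w' i f')
  let ?g = "substitute (\<lambda>i. Var (k + i)) f * (\<Prod>i\<in>{1..k}. Var i ^ n)"
  have "is_grothendieck (n + k) (skew_concat k w' n w)
      (isobaric_diff i (substitute (\<lambda>i. Var (k + i)) f * f' * (\<Prod>i\<in>{1..k}. Var i ^ n)))"
  proof (rule is_grothendieck_ascent)
    show "skew_concat k w' n w i < skew_concat k w' n w (i + 1)"
      using ascent by (simp add: skew_concat_def)
    show "is_grothendieck (n + k) (skew_concat k w' n w \<circ> transpose i (i + 1)) (substitute (\<lambda>i. Var (k + i)) f * f' * (\<Prod>i\<in>{1..k}. Var i ^ n))"
      using ascent by (subst skew_concat_transpose_left) (simp_all add: comp_def)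
  qed (use ascent in simp_all)
  also have "substitute (\<lambda>i. Var (k + i)) f * f' * (\<Prod>i\<in>{1..k}. Var i ^ n) = ?g * f'"
    by (simp only: ac_simps)
  \<comment> \<open>\<open>?g\<close> is symmetric: its shifted part lies beyond
    \<open>Var k\<close>, and its power product contains both swapped variables as
    \<open>i < k\<close>.\<close>
  also have "isobaric_diff i (?g * f') = ?g * isobaric_diff i f'"
    by (rule isobaric_diff_mult_symmetric, subst swap_vars_hom,
        subst swap_vars_shift_is_grothendieck[OF w], fact, subst swap_vars_symmetric_prod)
      (use ascent in auto)
  finally show ?case by (simp only: isobaric_diff_def ac_simps)
qed

text \<open>Induction over \<open>w\<close> with \<open>w'\<close> fixed. For the longest
  \<open>w\<close>, the preceding induction over \<open>w'\<close> applies, and it starts at the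
  longest permutation of \<open>{1..n + k}\<close>.\<close>

lemma is_grothendieck_skew_concat:
  assumes w: "is_grothendieck n w f" and w': "is_grothendieck k w' f'"
  shows "is_grothendieck (n + k) (skew_concat k w' n w)
    (substitute (\<lambda>i. Var (k + i)) f * f' * (\<Prod>i\<in>{1..k}. Var i ^ n))"
  using w
proof (induction rule: is_grothendieck.induct)
  case longest
  show ?case
    by (rule is_grothendieck_skew_concat_left[OF w' is_grothendieck.longest])
      (simp only: skew_concat_longest substitute_hom substitute_Var is_grothendieck.longest
        flip: longest_prod_append)
next
  case (ascent w i f)
  let ?shift = "substitute (\<lambda>i. Var (k + i))"
  let ?g = "f' * (\<Prod>i\<in>{1..k}. Var i ^ n)"
  have "is_grothendieck (n + k) (skew_concat k w' n w)
      (isobaric_diff (k + i) (?shift f * f' * (\<Prod>i\<in>{1..k}. Var i ^ n)))"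
  proof (rule is_grothendieck_ascent)
    show "skew_concat k w' n w (k + i) < skew_concat k w' n w (k + i + 1)"
      using ascent by (simp add: skew_concat_def)
    show "is_grothendieck (n + k) (skew_concat k w' n w \<circ> transpose (k + i) (k + i + 1)) (substitute (\<lambda>i. Var (k + i)) f * f' * (\<Prod>i\<in>{1..k}. Var i ^ n))"
      using ascent by (subst skew_concat_transpose_right) (simp_all add: comp_def)
  qed (use ascent in simp_all)
  also have "?shift f * f' * (\<Prod>i\<in>{1..k}. Var i ^ n) = ?g * ?shift f"
    by (simp only: ac_simps)
  \<comment> \<open>Both swapped variables lie beyond \<open>Var k\<close>, out of reach of
    \<open>f'\<close> and of the power product.\<close>
  also have "isobaric_diff (k + i) (?g * ?shift f) = ?g * isobaric_diff (k + i) (?shift f)"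
    by (rule isobaric_diff_mult_symmetric, subst swap_vars_hom,
        subst swap_vars_is_grothendieck[OF w'], use ascent in simp, subst swap_vars_symmetric_prod)
      (use ascent in auto)
  also have "isobaric_diff (k + i) (?shift f) = ?shift (isobaric_diff i f)"
    by (rule substitute_isobaric_diff[symmetric]) (auto simp: swap_vars_Var transpose_def)
  finally show ?case by (simp only: isobaric_diff_def ac_simps)
qed

theorem theorem5p7:
  fixes n k :: nat and w w' :: "nat \<Rightarrow> nat"
  assumes "w permutes {1..n}" and "w' permutes {1..k}"
  shows "grothendieck (n + k) (skew_concat k w' n w) =
    substitute (\<lambda>i. Var (k + i)) (grothendieck n w) * grothendieck k w' * (\<Prod>i\<in>{1..k}. Var i ^ n)"
  by (intro grothendieck_eqI is_grothendieck_skew_concat is_grothendieck_grothendieck assms)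

end
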